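(* Let $X$ be a complex Banach space, let $T\in C(X)$ and let $U$ be an open, connected subset of $\mathbb{C}$. The following conditions are equivalent: (i) There exist two families of bounded projections $P(\lambda)$ and $Q(\lambda)$ on $X$, $\lambda\in U$, continuous in $\lambda$, such that $$\operatorname{ran}(P(\lambda))=\operatorname{ran}(T-\lambda I),\qquad \ker(Q(\lambda))=\ker(T-\lambda I)\qquad(\lambda\in U)$$ and $$P(\lambda)P(\mu)=P(\lambda),\qquad Q(\lambda)Q(\mu)=Q(\mu)\qquad(\lambda,\mu\in U).$$ (ii) There exists a generalized resolvent of $T$ on $U$. (iii) There exists an analytic generalized inverse $R(\lambda)$ of $T$ on $U$ satisfying $R'(\lambda)=R(\lambda)^2$ for all $\lambda\in U$.
   Context: $C(X)$ is the set of closed, densely defined linear operators $T: D(T)\subseteq X\to X$, and $B(X)$ is the algebra of bounded linear operators on $X$ with the operator norm; continuity and analyticity of operator families are as $B(X)$-valued functions. $\ker$ and $\operatorname{ran}$ denote kernel and range; $I$ is the identity. A generalized inverse of $T\in C(X)$ is an operator $S\in B(X)$ with $\operatorname{ran}(S)\subseteq D(T)$ such that $TST=T$ on $D(T)$, $STS=S$ on $X$, and $ST$ (defined on $D(T)$) is continuous. An analytic generalized inverse of $T$ on $U$ is an analytic function $R:U\to B(X)$ such that $R(\lambda)$ is a generalized inverse of $T-\lambda I$ for every $\lambda\in U$. A generalized resolvent of $T$ on a connected open set $U$ is a function $R:U\to B(X)$ such that $R(\lambda)$ is a generalized inverse of $T-\lambda I$ for every $\lambda\in U$ and $R(\lambda)-R(\mu)=(\lambda-\mu)R(\lambda)R(\mu)$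 for all $\lambda,\mu\in U$. *)

theory Defs
  imports "HOL-Analysis.Analysis"
begin

text \<open>
  Complex Banach spaces are real Banach spaces (class \<open>banach\<close>) with a complex scalar
  multiplication that extends the real one and is compatible with the norm.
\<close>

class scaleC =
  fixes scaleC :: "complex \<Rightarrow> 'a \<Rightarrow> 'a" (infixr "*\<^sub>C" 75)

class complex_vector = real_vector + scaleC +
  assumes scaleC_add_right: "a *\<^sub>C (x + y) = a *\<^sub>C x + a *\<^sub>C y"
    and scaleC_add_left: "(a + b) *\<^sub>C x = a *\<^sub>C x + b *\<^sub>C x"
    and scaleC_scaleC: "a *\<^sub>C b *\<^sub>C x = (a * b) *\<^sub>C x"
    and scaleC_one: "1 *\<^sub>C x = x"
    and scaleR_scaleC: "r *\<^sub>R x = complex_of_real r *\<^sub>C x"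

class complex_normed_vector = complex_vector + real_normed_vector +
  assumes norm_scaleC: "norm (a *\<^sub>C x) = cmod a * norm x"

class complex_banach = complex_normed_vector + banach

lemma vector_space_scaleC: "vector_space (scaleC :: complex \<Rightarrow> 'a::complex_vector \<Rightarrow> 'a)"
  by unfold_locales
    (simp_all add: scaleC_add_right scaleC_add_left scaleC_scaleC scaleC_one)

instantiation complex :: complex_banach
begin

definition scaleC_complex :: "complex \<Rightarrow> complex \<Rightarrow> complex"
  where "scaleC_complex a x = a * x"

instance
  by standard (simp_all add: scaleC_complex_def algebra_simps scaleR_conv_of_real norm_mult)

end

lemma bounded_linear_scaleC:
  "bounded_linear (\<lambda>x :: 'a::complex_normed_vector. a *\<^sub>C x)"
proof
  show "a *\<^sub>C (x + y) = a *\<^sub>C x + a *\<^sub>C y" for x y :: 'a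
    by (rule scaleC_add_right)
  show "a *\<^sub>C r *\<^sub>R x = r *\<^sub>R a *\<^sub>C x" for r and x :: 'a
    by (simp add: scaleR_scaleC scaleC_scaleC mult.commute)
  show "\<exists>K. \<forall>x :: 'a. norm (a *\<^sub>C x) \<le> norm x * K"
    by (rule exI[of _ "cmod a"]) (simp add: norm_scaleC mult.commute)
qed

text \<open>
  The type \<open>'a \<Rightarrow>\<^sub>L 'a\<close> of the library consists of the bounded real-linear operators
  with the operator norm. It is a complex normed space with the pointwise scalar multiplication,
  and \<open>B(X)\<close> is its closed subalgebra of complex-linear operators, with the inherited norm.
\<close>

instantiation blinfun :: (real_normed_vector, complex_normed_vector) complex_normed_vector
begin

lift_definition scaleC_blinfun :: "complex \<Rightarrow> ('a \<Rightarrow>\<^sub>L 'b) \<Rightarrow> ('a \<Rightarrow>\<^sub>L 'b)"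
  is "\<lambda>a f x. a *\<^sub>C f x"
  by (rule bounded_linear_compose[OF bounded_linear_scaleC])

instance
proof
  fix a b :: complex and r :: real and f g :: "'a \<Rightarrow>\<^sub>L 'b"
  show "a *\<^sub>C (f + g) = a *\<^sub>C f + a *\<^sub>C g"
    by transfer (simp add: scaleC_add_right)
  show "(a + b) *\<^sub>C f = a *\<^sub>C f + b *\<^sub>C f"
    by transfer (simp add: scaleC_add_left)
  show "a *\<^sub>C b *\<^sub>C f = (a * b) *\<^sub>C f"
    by transfer (simp add: scaleC_scaleC)
  show "1 *\<^sub>C f = f"
    by transfer (simp add: scaleC_one)
  show "r *\<^sub>R f = complex_of_real r *\<^sub>C f"
    by transfer (simp add: scaleR_scaleC)
  show "norm (a *\<^sub>C f) = cmod a * norm f"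
  proof (cases "a = 0")
    case True
    have "(0 :: complex) *\<^sub>C f = 0"
      by transfer (metis scaleR_scaleC of_real_0 scaleR_zero_left)
    then show ?thesis using True by simp
  next
    case False
    have le: "norm (c *\<^sub>C h) \<le> cmod c * norm h" for c and h :: "'a \<Rightarrow>\<^sub>L 'b"
      by (rule norm_blinfun_bound)
        (auto simp: scaleC_blinfun.rep_eq norm_scaleC mult.assoc
          intro!: mult_left_mono norm_blinfun)
    have "inverse a *\<^sub>C a *\<^sub>C f = f"
      using False by transfer (simp add: scaleC_scaleC scaleC_one)
    then have "norm f \<le> cmod (inverse a) * norm (a *\<^sub>C f)"
      using le[of "inverse a" "a *\<^sub>C f"] by simp
    then have "cmod a * norm f \<le> norm (a *\<^sub>C f)"
      using False by (simp add: norm_inverse norm_divide field_simps)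
    with le[of a f] show ?thesis by simp
  qed
qed

end

definition bounded_ops :: "('a::complex_normed_vector \<Rightarrow>\<^sub>L 'a) set"
  where "bounded_ops = {A :: 'a \<Rightarrow>\<^sub>L 'a. \<forall>a x. A (a *\<^sub>C x) = a *\<^sub>C A x}"

definition bounded_projection :: "('a::complex_normed_vector \<Rightarrow>\<^sub>L 'a) \<Rightarrow> bool"
  where "bounded_projection P \<longleftrightarrow> P \<in> bounded_ops \<and> P o\<^sub>L P = P"

text \<open>Complex derivatives and analyticity of functions with values in a complex normed space,
  in analogy with \<open>has_vector_derivative\<close> and \<open>analytic_on\<close>.\<close>

definition has_complex_derivative ::
    "(complex \<Rightarrow> 'b::complex_normed_vector) \<Rightarrow> 'b \<Rightarrow> complex filter \<Rightarrow> bool"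
    (infix "(has'_complex'_derivative)" 50)
  where "(f has_complex_derivative f') F \<longleftrightarrow> (f has_derivative (\<lambda>h. h *\<^sub>C f')) F"

lemma has_complex_derivative_complex_iff:
  "(f has_complex_derivative f') F \<longleftrightarrow> (f has_field_derivative f') F" for f :: "complex \<Rightarrow> complex"
  unfolding has_complex_derivative_def has_field_derivative_def scaleC_complex_def
  by (subst mult.commute) (rule refl)

definition vector_analytic_on ::
    "(complex \<Rightarrow> 'b::complex_normed_vector) \<Rightarrow> complex set \<Rightarrow> bool"
    (infix "(vector'_analytic'_on)" 50)
  where "f vector_analytic_on U \<longleftrightarrow>
    (\<forall>z\<in>U. \<exists>e>0. \<forall>w\<in>ball z e. \<exists>f'. (f has_complex_derivative f') (at w))"

text \<open>
  An unbounded operator is given by its domain \<open>D\<close> and a function \<open>T\<close>, of which only the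
  values on \<open>D\<close> matter. The set \<open>C(X)\<close> is the following predicate.
\<close>

definition closed_densely_defined :: "'a::complex_normed_vector set \<Rightarrow> ('a \<Rightarrow> 'a) \<Rightarrow> bool"
  where "closed_densely_defined D T \<longleftrightarrow>
    module.subspace scaleC D \<and>
    (\<forall>x\<in>D. \<forall>y\<in>D. T (x + y) = T x + T y) \<and>
    (\<forall>a. \<forall>x\<in>D. T (a *\<^sub>C x) = a *\<^sub>C T x) \<and>
    closure D = UNIV \<and>
    closed {(x, T x) |x. x \<in> D}"

definition shift_op :: "('a::complex_normed_vector \<Rightarrow> 'a) \<Rightarrow> complex \<Rightarrow> 'a \<Rightarrow> 'a"
  where "shift_op T z = (\<lambda>x. T x - z *\<^sub>C x)"

definition op_ker :: "'a set \<Rightarrow> ('a \<Rightarrow> 'a::zero) \<Rightarrow> 'a set"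
  where "op_ker D T = {x \<in> D. T x = 0}"

definition op_ran :: "'a set \<Rightarrow> ('a \<Rightarrow> 'a) \<Rightarrow> 'a set"
  where "op_ran D T = T ` D"

definition generalized_inverse ::
    "'a::complex_normed_vector set \<Rightarrow> ('a \<Rightarrow> 'a) \<Rightarrow> ('a \<Rightarrow>\<^sub>L 'a) \<Rightarrow> bool"
  where "generalized_inverse D T S \<longleftrightarrow>
    S \<in> bounded_ops \<and>
    op_ran UNIV S \<subseteq> D \<and>
    (\<forall>x\<in>D. T (S (T x)) = T x) \<and>
    (\<forall>x. S (T (S x)) = S x) \<and>
    continuous_on D (\<lambda>x. S (T x))"

definition analytic_generalized_inverse ::
    "'a::complex_normed_vector set \<Rightarrow> ('a \<Rightarrow> 'a) \<Rightarrow> complex set \<Rightarrow>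
      (complex \<Rightarrow> ('a \<Rightarrow>\<^sub>L 'a)) \<Rightarrow> bool"
  where "analytic_generalized_inverse D T U R \<longleftrightarrow>
    R vector_analytic_on U \<and>
    (\<forall>z\<in>U. generalized_inverse D (shift_op T z) (R z))"

definition generalized_resolvent ::
    "'a::complex_normed_vector set \<Rightarrow> ('a \<Rightarrow> 'a) \<Rightarrow> complex set \<Rightarrow>
      (complex \<Rightarrow> ('a \<Rightarrow>\<^sub>L 'a)) \<Rightarrow> bool"
  where "generalized_resolvent D T U R \<longleftrightarrow>
    (\<forall>z\<in>U. generalized_inverse D (shift_op T z) (R z)) \<and>
    (\<forall>z\<in>U. \<forall>w\<in>U. R z - R w = (z - w) *\<^sub>C (R z o\<^sub>L R w))"

end

theory Submission
  imports Defs
begin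

text \<open>
  The identity \<open>P(\<lambda>)P(\<mu>) = P(\<lambda>)\<close> says that all \<open>P(\<lambda>)\<close> have the same kernel, and \<open>Q(\<lambda>)Q(\<mu>) = Q(\<mu>)\<close>
  that all \<open>Q(\<lambda>)\<close> have the same range. Given (i), let \<open>R(\<lambda>)x = Q(\<lambda>)u\<close> for any \<open>u\<close> with
  \<open>(T - \<lambda>)u = P(\<lambda>)x\<close>; it is bounded by the closed graph theorem, and evaluating
  \<open>R(\<lambda>)((T - \<mu>) - (T - \<lambda>))R(\<mu>)\<close> in two ways gives the resolvent identity. Conversely,
  \<open>P(\<lambda>) = (T - \<lambda>)R(\<lambda>)\<close> and the continuous extension \<open>Q(\<lambda>)\<close> of \<open>R(\<lambda>)(T - \<lambda>)\<close> are as in (i),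
  because the resolvent identity makes the kernel and the range of \<open>R(\<lambda>)\<close> independent of \<open>\<lambda>\<close>.

  The resolvent identity bounds \<open>\<parallel>R(\<lambda>)\<parallel>\<close> by \<open>2\<parallel>R(\<mu>)\<parallel>\<close> near \<open>\<mu>\<close>, hence \<open>R\<close> is continuous and then
  \<open>R' = R\<^sup>2\<close>. Conversely, if \<open>R' = R\<^sup>2\<close>, then for fixed \<open>\<mu>\<close> the function
  \<open>F(\<lambda>) = R(\<lambda>) - R(\<mu>) - (\<lambda> - \<mu>)R(\<lambda>)R(\<mu>)\<close> solves \<open>F' = RF\<close>, \<open>F(\<mu>) = 0\<close>, and therefore vanishes
  on the connected set \<open>U\<close>.
\<close>

section \<open>The closed graph theorem in Banach spaces\<close>

text \<open>By Baire's theorem some sublevel set \<open>A n\<close> is dense in a ball. Linearity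
  then lets every x be approximated, up to half its norm, by a y with \<open>norm (f y)\<close> at
  most a fixed multiple of \<open>norm x\<close>. Iterating this writes x as a series whose images
  converge absolutely, and the graph hypothesis identifies their sum with
  \<open>f x\<close>.\<close>

lemma closed_graph_bounded_linear:
  fixes f :: "'a::banach \<Rightarrow> 'b::banach"
  assumes "linear f" and graph: "\<And>s x y. s \<longlonglongrightarrow> x \<Longrightarrow> (\<lambda>n. f (s n)) \<longlonglongrightarrow> y \<Longrightarrow> f x = y"
  shows "bounded_linear f"
proof -
  interpret linear f by fact
  define A where "A n = {x. norm (f x) \<le> real n}" for n :: nat
  have UN: "(\<Union>n. closure (A n)) = UNIV"
  proof -
    have "x \<in> (\<Union>n. closure (A n))" for x
      using real_arch_simple[of "norm (f x)"] closure_subset[of "A _"] by (auto simp: A_def)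
    then show ?thesis by blast
  qed
  have "\<exists>n. interior (closure (A n)) \<noteq> {}"
  proof (rule ccontr)
    assume "\<not> ?thesis"
    then have "\<And>n. interior (closure (A n)) = {}" by blast
    then have "(euclidean :: 'a topology) interior_of \<Union>(range (\<lambda>n. closure (A n))) = {}"
      by (intro Baire_category_alt)
        (auto simp: completely_metrizable_space_euclidean)
    with UN show False by simp
  qed
  then obtain n x0 where "x0 \<in> interior (closure (A n))" by blast
  then obtain r where r: "r > 0" "cball x0 r \<subseteq> closure (A n)"
    by (meson mem_interior_cball)
  \<comment> \<open>Differences of elements of \<open>A n\<close> are dense in \<open>cball 0 r\<close>; rescale \<open>x\<close> into that ball.\<close>
  have approx: "\<exists>y. norm (f y) \<le> 2 * real n / r * norm x \<and> norm (x - y) \<le> norm x / 2" for x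
  proof (cases "x = 0")
    case True
    then show ?thesis by (intro exI[of _ 0]) simp
  next
    case False
    define t where "t = r / norm x"
    have t: "t > 0" "t * norm x = r" using r False by (auto simp: t_def)
    have "x0 \<in> closure (A n)" "x0 + t *\<^sub>R x \<in> closure (A n)"
      using r t by (auto simp: subset_iff dist_norm)
    moreover have "r / 4 > 0" using r by simp
    ultimately obtain a b where ab: "a \<in> A n" "b \<in> A n"
        "dist a x0 < r / 4" "dist b (x0 + t *\<^sub>R x) < r / 4"
      unfolding closure_approachable by blast
    have "norm (f (b - a)) \<le> 2 * real n"
      using norm_triangle_ineq4[of "f b" "f a"] ab by (simp add: A_def diff)
    moreover have "norm (t *\<^sub>R x - (b - a)) \<le> r / 2"
    proof -
      have eq: "t *\<^sub>R x - (b - a) = (a - x0) - (b - (x0 + t *\<^sub>R x))" by simp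
      have "norm (t *\<^sub>R x - (b - a)) \<le> norm (a - x0) + norm (b - (x0 + t *\<^sub>R x))"
        unfolding eq by (rule norm_triangle_ineq4)
      then show ?thesis using ab(3,4) unfolding dist_norm by linarith
    qed
    moreover have "x - (1 / t) *\<^sub>R (b - a) = (1 / t) *\<^sub>R (t *\<^sub>R x - (b - a))"
      using t by (simp add: algebra_simps)
    moreover have "(1 / t) * norm (t *\<^sub>R x - (b - a)) \<le> (1 / t) * (r / 2)"
        "(1 / t) * norm (f (b - a)) \<le> (1 / t) * (2 * real n)"
      by (rule mult_left_mono; use calculation t in simp)+
    ultimately have "norm (x - (1 / t) *\<^sub>R (b - a)) \<le> (1 / t) * (r / 2)"
        "norm (f ((1 / t) *\<^sub>R (b - a))) \<le> (1 / t) * (2 * real n)"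
      using t by (simp_all only: norm_scaleR scale) simp_all
    then show ?thesis using t r False
      by (intro exI[of _ "(1 / t) *\<^sub>R (b - a)"]) (simp add: t_def field_simps)
  qed
  define C where "C = 2 * real n / r"
  have C: "C \<ge> 0" using r by (simp add: C_def)
  obtain g where g: "\<And>x. norm (f (g x)) \<le> C * norm x" "\<And>x. norm (x - g x) \<le> norm x / 2"
    using approx unfolding C_def by metis
  have "norm (f x) \<le> norm x * (2 * C)" for x
  proof -
    \<comment> \<open>\<open>u k\<close> is the remainder after k approximation steps. It at least
      halves each time, so the terms \<open>g (u i)\<close> sum to x and their images are dominated
      by a geometric series with sum 2C times the norm of x.\<close>
    define u where "u k = ((\<lambda>x. x - g x) ^^ k) x" for k
    have u_Suc: "u (Suc k) = u k - g (u k)" for k by (simp add: u_def)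
    have u: "norm (u k) \<le> (1/2) ^ k * norm x" for k
    proof (induction k)
      case (Suc k)
      then show ?case using g(2)[of "u k"] by (simp add: u_Suc)
    qed (simp add: u_def)
    have sum_g: "(\<Sum>i<k. g (u i)) = x - u k" for k
      by (induction k) (auto simp: u_Suc, simp add: u_def)
    have geo: "(\<lambda>k. C * ((1/2) ^ k * norm x)) sums (norm x * (2 * C))"
      using sums_mult[OF sums_mult2[OF geometric_sums[of "1/2::real"]], of C "norm x"]
      by (simp add: mult_ac)
    have fg: "norm (f (g (u k))) \<le> C * ((1/2) ^ k * norm x)" for k
      using g(1)[of "u k"] mult_left_mono[OF u C] by (rule order_trans)
    have summ: "summable (\<lambda>k. norm (f (g (u k))))"
      by (rule summable_comparison_test'[OF sums_summable[OF geo]]) (use fg in auto)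
    have "(\<lambda>k. (1/2) ^ k * norm x) \<longlonglongrightarrow> 0 * norm x"
      by (intro tendsto_mult tendsto_const LIMSEQ_power_zero) simp
    then have "u \<longlonglongrightarrow> 0"
      by (intro Lim_null_comparison[of u]) (use u in auto)
    then have "(\<lambda>k. \<Sum>i<k. g (u i)) \<longlonglongrightarrow> x"
      unfolding sum_g by (auto intro: tendsto_eq_intros)
    moreover have "(\<lambda>k. f (\<Sum>i<k. g (u i))) \<longlonglongrightarrow> (\<Sum>k. f (g (u k)))"
      using summable_LIMSEQ[OF summable_norm_cancel[OF summ]] by (simp add: sum)
    ultimately have "f x = (\<Sum>k. f (g (u k)))" by (rule graph)
    also have "norm \<dots> \<le> (\<Sum>k. norm (f (g (u k))))" by (rule summable_norm[OF summ])
    also have "\<dots> \<le> norm x * (2 * C)"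
      using suminf_le[OF fg summ sums_summable[OF geo]] sums_unique[OF geo] by simp
    finally show ?thesis .
  qed
  then show ?thesis by (intro bounded_linear_intro[of f]) (auto simp: add scale)
qed

section \<open>Complex-linear bounded operators and density arguments\<close>

text \<open>Supplies the limit, continuity and product rules for complex scalar multiplication used
  throughout.\<close>

lemma bounded_bilinear_scaleC [bounded_bilinear]:
  "bounded_bilinear (scaleC :: complex \<Rightarrow> 'a \<Rightarrow> 'a::complex_normed_vector)"
proof
  show "(r *\<^sub>R a) *\<^sub>C b = r *\<^sub>R a *\<^sub>C b" for r a and b :: 'a
    by (simp only: scaleR_scaleC[where 'a = 'a] scaleC_scaleC scaleR_conv_of_real)
  show "a *\<^sub>C r *\<^sub>R b = r *\<^sub>R a *\<^sub>C b" for r a and b :: 'a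
    by (simp only: scaleR_scaleC[where 'a = 'a] scaleC_scaleC mult.commute)
  show "\<exists>K. \<forall>a. \<forall>b :: 'a. norm (a *\<^sub>C b) \<le> norm a * norm b * K"
    by (rule exI[of _ 1]) (simp add: norm_scaleC)
qed (simp_all add: scaleC_add_left scaleC_add_right)

interpretation scaleC: bounded_bilinear "scaleC :: complex \<Rightarrow> 'a \<Rightarrow> 'a::complex_normed_vector"
  by (rule bounded_bilinear_scaleC)

interpretation blinfun_compose: bounded_bilinear
    "blinfun_compose :: ('a::real_normed_vector \<Rightarrow>\<^sub>L 'b::real_normed_vector) \<Rightarrow> ('c::real_normed_vector \<Rightarrow>\<^sub>L 'a) \<Rightarrow> _"
  by (rule bounded_bilinear_blinfun_compose)

lemma blinfun_compose_assoc:
  "(A o\<^sub>L B) o\<^sub>L C = A o\<^sub>L (B o\<^sub>L C)"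
  by (rule blinfun_eqI) simp

lemma bounded_opsD: "A \<in> bounded_ops \<Longrightarrow> A (a *\<^sub>C x) = a *\<^sub>C A x"
  by (simp add: bounded_ops_def)

lemma bounded_opE:
  fixes f :: "'a::complex_normed_vector \<Rightarrow> 'a"
  assumes "bounded_linear f" and "\<And>a x. f (a *\<^sub>C x) = a *\<^sub>C f x"
  obtains A where "A \<in> bounded_ops" "\<And>x. blinfun_apply A x = f x"
  using that[of "Blinfun f"] assms by (simp add: bounded_ops_def bounded_linear_Blinfun_apply)

lemma closed_graph_bounded_op:
  fixes f :: "'a::complex_banach \<Rightarrow> 'a"
  assumes add: "\<And>x y. f (x + y) = f x + f y"
    and scale: "\<And>a x. f (a *\<^sub>C x) = a *\<^sub>C f x"
    and graph: "\<And>s x y. s \<longlonglongrightarrow> x \<Longrightarrow> (\<lambda>n. f (s n)) \<longlonglongrightarrow> y \<Longrightarrow> f x = y"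
  obtains A where "A \<in> bounded_ops" "\<And>x. blinfun_apply A x = f x"
proof (rule bounded_opE[OF _ scale])
  have "linear f"
    by (rule linearI) (simp_all add: add scale scaleR_scaleC)
  then show "bounded_linear f"
    by (rule closed_graph_bounded_linear) (rule graph)
qed blast

lemma eq_on_dense:
  fixes f g :: "'a::topological_space \<Rightarrow> 'b::real_normed_vector"
  assumes "closure D = UNIV" "continuous_on UNIV f" "continuous_on UNIV g"
    and "\<And>x. x \<in> D \<Longrightarrow> f x = g x"
  shows "f x = g x"
proof -
  have "f x - g x = 0"
    by (rule continuous_constant_on_closure[of D "\<lambda>x. f x - g x"])
      (use assms in \<open>auto intro: continuous_on_diff\<close>)
  then show ?thesis by simp
qed

lemma blinfun_eq_on_dense:
  assumes "closure D = UNIV" and "\<And>x. x \<in> D \<Longrightarrow> blinfun_apply A x = blinfun_apply B x"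
  shows "A = B"
  by (rule blinfun_eqI, rule eq_on_dense[OF assms(1)]) (auto intro!: continuous_intros assms(2))

section \<open>Shifts of a closed operator and extension of operators from its domain\<close>

locale closed_op =
  fixes D :: "'a::complex_banach set" and T :: "'a \<Rightarrow> 'a"
  assumes closed_densely_defined: "closed_densely_defined D T"
begin

sublocale scaleC_space: vector_space "scaleC :: complex \<Rightarrow> 'a \<Rightarrow> 'a"
  by (rule vector_space_scaleC)

lemma subspace: "module.subspace scaleC D" and dense: "closure D = UNIV"
  and closed_graph: "closed {(x, T x) |x. x \<in> D}"
  and T_add: "x \<in> D \<Longrightarrow> y \<in> D \<Longrightarrow> T (x + y) = T x + T y"
  and T_scaleC: "x \<in> D \<Longrightarrow> T (a *\<^sub>C x) = a *\<^sub>C T x"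
  using closed_densely_defined unfolding closed_densely_defined_def by blast+

lemmas D_add = scaleC_space.subspace_add[OF subspace]
lemmas D_diff = scaleC_space.subspace_diff[OF subspace]
lemmas D_scaleC = scaleC_space.subspace_scale[OF subspace]
lemmas D_0 = scaleC_space.subspace_0[OF subspace]

lemma shift_add: "x \<in> D \<Longrightarrow> y \<in> D \<Longrightarrow> shift_op T z (x + y) = shift_op T z x + shift_op T z y"
  by (simp add: shift_op_def T_add scaleC.add_right)

lemma shift_scaleC: "x \<in> D \<Longrightarrow> shift_op T z (a *\<^sub>C x) = a *\<^sub>C shift_op T z x"
  by (simp add: shift_op_def T_scaleC scaleC.diff_right scaleC_scaleC mult.commute)

lemma shift_diff: "x \<in> D \<Longrightarrow> y \<in> D \<Longrightarrow> shift_op T z (x - y) = shift_op T z x - shift_op T z y"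
  using shift_add[of "x - y" y z] by (simp add: D_diff)

lemma shift_shift: "shift_op T w x = shift_op T z x + (z - w) *\<^sub>C x"
  by (simp add: shift_op_def scaleC.diff_left)

text \<open>Adding \<open>z *\<^sub>C s n\<close> back turns convergence of the shifted values into
  convergence of \<open>T (s n)\<close>, so every shift inherits closedness from T.\<close>

lemma shift_closed:
  assumes "\<And>n. s n \<in> D" "s \<longlonglongrightarrow> x" "(\<lambda>n. shift_op T z (s n)) \<longlonglongrightarrow> y"
  shows "x \<in> D" "shift_op T z x = y"
proof -
  have "(\<lambda>n. shift_op T z (s n) + z *\<^sub>C s n) \<longlonglongrightarrow> y + z *\<^sub>C x"
    by (rule tendsto_add[OF assms(3) scaleC.tendsto[OF tendsto_const assms(2)]])
  then have "(\<lambda>n. T (s n)) \<longlonglongrightarrow> y + z *\<^sub>C x"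
    by (simp add: shift_op_def)
  then have "(\<lambda>n. (s n, T (s n))) \<longlonglongrightarrow> (x, y + z *\<^sub>C x)"
    by (rule tendsto_Pair[OF assms(2)])
  moreover have "(s n, T (s n)) \<in> {(x, T x) |x. x \<in> D}" for n
    using assms(1) by blast
  ultimately have "(x, y + z *\<^sub>C x) \<in> {(x, T x) |x. x \<in> D}"
    by (metis (no_types, lifting) closed_sequentially[OF closed_graph])
  then have "x \<in> D" "T x = y + z *\<^sub>C x" by simp_all
  then show "x \<in> D" "shift_op T z x = y" by (simp_all add: shift_op_def)
qed

text \<open>Continuity at 0 makes a linear f Lipschitz on D, hence f extends continuously to the
  closure of D, which is everything. Linearity and the bound pass to the extension by density. The
  case of interest is R(T - z), which is given only on D.\<close>

lemma extend_bounded_op: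
  assumes add: "\<And>x y. x \<in> D \<Longrightarrow> y \<in> D \<Longrightarrow> f (x + y) = f x + f y"
    and scale: "\<And>a x. x \<in> D \<Longrightarrow> f (a *\<^sub>C x) = a *\<^sub>C f x"
    and cont: "continuous_on D f"
  obtains A :: "'a \<Rightarrow>\<^sub>L 'a" where "A \<in> bounded_ops" "\<And>x. x \<in> D \<Longrightarrow> blinfun_apply A x = f x"
proof -
  have diff: "f (x - y) = f x - f y" if "x \<in> D" "y \<in> D" for x y
    using add[of "x - y" y] that by (simp add: D_diff)
  have f0: "f 0 = 0" using diff[OF D_0 D_0] by simp
  obtain d where d: "d > 0" "\<And>x. x \<in> D \<Longrightarrow> norm x < d \<Longrightarrow> norm (f x) < 1"
    using cont D_0 unfolding continuous_on_iff by (metis dist_0_norm dist_commute f0 zero_less_one)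
  have bound: "norm (f x) \<le> 2 / d * norm x" if "x \<in> D" for x
  proof (cases "x = 0")
    case False
    \<comment> \<open>This factor brings x to norm d/2, inside the ball on which f has norm below 1;
      undoing the scaling gives the constant 2/d.\<close>
    define c where "c = complex_of_real (d / (2 * norm x))"
    have c: "cmod c = d / (2 * norm x)" using d by (simp add: c_def norm_divide norm_mult)
    then have "norm (f (c *\<^sub>C x)) < 1"
      using d False that by (intro d D_scaleC) (simp_all add: norm_scaleC)
    then show ?thesis using d False that by (simp add: scale norm_scaleC c field_simps)
  qed (simp add: f0)
  have "(2 / d)-lipschitz_on D f"
    using bound[OF D_diff] d by (intro lipschitz_onI) (auto simp: dist_norm diff)
  then obtain g where g: "uniformly_continuous_on UNIV g" "\<And>x. x \<in> D \<Longrightarrow> f x = g x"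
    using uniformly_continuous_on_extension_on_closure[OF lipschitz_on_uniformly_continuous] dense
    by metis
  have cont_g: "continuous_on UNIV g" by (rule uniformly_continuous_imp_continuous[OF g(1)])
  have cont_comp: "continuous_on UNIV (\<lambda>x. g (h x))" if "continuous_on UNIV h" for h :: "'a \<Rightarrow> 'a"
    by (rule continuous_on_compose2[OF cont_g that]) simp
  have g_scale: "g (a *\<^sub>C x) = a *\<^sub>C g x" for a x
    by (rule eq_on_dense[OF dense])
      (auto intro!: continuous_intros cont_comp cont_g simp: g(2)[symmetric] scale D_scaleC)
  \<comment> \<open>Additivity is extended one argument at a time: first x leaves D, then y.\<close>
  have g_add1: "g (x + y) = g x + g y" if "y \<in> D" for x y
    by (rule eq_on_dense[OF dense])
      (use that in \<open>auto intro!: continuous_intros cont_comp cont_g simp: g(2)[symmetric] add D_add\<close>)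
  have g_add: "g (x + y) = g x + g y" for x y
    by (rule eq_on_dense[OF dense, where x = y])
      (auto intro!: continuous_intros cont_comp cont_g simp: g_add1)
  have "norm (g x) \<le> norm x * (2 / d)" for x
  proof -
    have "closed {x. norm (g x) \<le> norm x * (2 / d)}"
      by (intro closed_Collect_le continuous_intros cont_g)
    then have "closure D \<subseteq> {x. norm (g x) \<le> norm x * (2 / d)}"
      using bound by (intro closure_minimal) (auto simp: g(2)[symmetric] mult.commute)
    then show ?thesis using dense by auto
  qed
  then have "bounded_linear g"
    by (intro bounded_linear_intro[of g "2 / d"]) (simp_all add: g_add scaleR_scaleC g_scale)
  then show thesis
    using that bounded_opE[of g] g_scale g(2) by metis
qed

section \<open>From families of projections to a generalized resolvent\<close>

text \<open>\<open>R x\<close> is the u in D with (T - z)u = Px and Qu = u. It exists because the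
  ranges of P and T - z agree. It is unique because the difference of two solutions lies in the
  common kernel of T - z and Q, yet is fixed by Q. The identities RP = R and QR = R are exported
  because they allow P and Q at one parameter to be replaced by those at another.\<close>

lemma projections_imp_generalized_inverse:
  assumes P: "bounded_projection P" and Q: "bounded_projection Q"
    and ran: "op_ran UNIV P = op_ran D (shift_op T z)"
    and ker: "op_ker UNIV Q = op_ker D (shift_op T z)"
  shows "\<exists>R. generalized_inverse D (shift_op T z) R \<and> (\<forall>x. R x \<in> D) \<and>
    (\<forall>x. shift_op T z (R x) = P x) \<and> (\<forall>x\<in>D. R (shift_op T z x) = Q x) \<and>
    R o\<^sub>L P = R \<and> Q o\<^sub>L R = R"
proof -
  let ?S = "shift_op T z"
  let ?sol = "\<lambda>x u. u \<in> D \<and> ?S u = P x \<and> Q u = u"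
  have Pops: "P \<in> bounded_ops" and Qops: "Q \<in> bounded_ops"
    and PP: "P (P x) = P x" and QQ: "Q (Q x) = Q x" for x
    using P Q unfolding bounded_projection_def by (auto simp flip: blinfun_apply_blinfun_compose)
  have Qdiff: "x - Q x \<in> op_ker D ?S" for x
    unfolding ker[symmetric] by (simp add: op_ker_def blinfun.diff_right QQ)
  \<comment> \<open>As x - Qx lies in the kernel of T - z, a subspace of D, Q preserves D and does
    not change the value of T - z.\<close>
  have QD: "Q x \<in> D" "?S (Q x) = ?S x" if "x \<in> D" for x
    using D_diff[OF that, of "x - Q x"] shift_diff[OF that, of "x - Q x" z] Qdiff[of x]
    by (auto simp: op_ker_def)
  have PS: "P (?S x) = ?S x" if "x \<in> D" for x
  proof -
    have "?S x \<in> op_ran UNIV P" using that unfolding ran by (simp add: op_ran_def)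
    then show ?thesis by (auto simp: op_ran_def PP)
  qed
  \<comment> \<open>Any preimage u of Px is corrected to Qu, which is still a preimage and is fixed
    by Q.\<close>
  have ex: "\<exists>u. ?sol x u" for x
  proof -
    have "P x \<in> op_ran D ?S" unfolding ran[symmetric] by (simp add: op_ran_def)
    then obtain u where "u \<in> D" "?S u = P x" by (auto simp: op_ran_def)
    then show ?thesis using QD[of u] QQ by (intro exI[of _ "Q u"]) simp
  qed
  have uniq: "u = v" if "?sol x u" "?sol x v" for x u v
  proof -
    have "u - v \<in> op_ker D ?S" using that by (simp add: op_ker_def D_diff shift_diff)
    then have "Q (u - v) = 0" unfolding ker[symmetric] by (simp add: op_ker_def)
    then show ?thesis using that by (simp add: blinfun.diff_right)
  qed
  obtain f where f: "\<And>x. ?sol x (f x)" using ex by metis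
  have f_eq: "f x = u" if "?sol x u" for x u using uniq[OF f that] .
  obtain R where R: "R \<in> bounded_ops" "\<And>x. blinfun_apply R x = f x"
  proof (rule closed_graph_bounded_op)
    show "f (x + y) = f x + f y" for x y
      using f[of x] f[of y] by (intro f_eq) (simp add: D_add shift_add blinfun.add_right)
    show "f (a *\<^sub>C x) = a *\<^sub>C f x" for a x
      using f[of x] by (intro f_eq) (simp add: D_scaleC shift_scaleC bounded_opsD[OF Pops] bounded_opsD[OF Qops])
    \<comment> \<open>The limit y satisfies the conditions defining \<open>f x\<close>: closedness
      of T - z gives the first two, continuity of Q the third.\<close>
    show "f x = y" if "s \<longlonglongrightarrow> x" "(\<lambda>n. f (s n)) \<longlonglongrightarrow> y" for s x y
    proof -
      have "(\<lambda>n. ?S (f (s n))) \<longlonglongrightarrow> P x"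
        using f that(1) by (simp add: blinfun.tendsto)
      then have "y \<in> D" "?S y = P x"
        using shift_closed[of "\<lambda>n. f (s n)" y z "P x"] f that by auto
      moreover have "(\<lambda>n. Q (f (s n))) \<longlonglongrightarrow> Q y"
        using that(2) by (intro blinfun.tendsto tendsto_const)
      then have "Q y = y" using f that(2) by (simp add: LIMSEQ_unique)
      ultimately show ?thesis by (intro f_eq) simp
    qed
  qed blast
  have RS: "R (?S x) = Q x" if "x \<in> D" for x
    using QD[OF that] QQ unfolding R(2) by (intro f_eq) (simp add: PS that)
  have "f (P x) = f x" for x
    using f[of x] by (intro f_eq) (simp add: PP)
  then have RP: "R o\<^sub>L P = R" and QR: "Q o\<^sub>L R = R"
    using f by (auto intro!: blinfun_eqI simp: R(2))
  have "generalized_inverse D ?S R"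
    unfolding generalized_inverse_def
  proof (intro conjI ballI allI)
    show "continuous_on D (\<lambda>x. R (?S x))"
      by (subst continuous_on_cong[OF refl RS]) (auto intro!: continuous_intros)
    show "?S (R (?S x)) = ?S x" if "x \<in> D" for x
      using QD[OF that] by (simp add: RS that)
    show "R (?S (R x)) = R x" for x
      using RS[of "R x"] f[of x] by (simp add: R(2))
    show "op_ran UNIV R \<subseteq> D"
      using f by (auto simp: op_ran_def R)
  qed (fact R)
  moreover have "R x \<in> D" "?S (R x) = P x" for x using f by (simp_all add: R)
  ultimately show ?thesis using RS RP QR by blast
qed

text \<open>Inserting P(z) and Q(w) gives R(z)P(w) = R(z)P(z)P(w) = R(z)P(z) = R(z) and Q(z)R(w) =
  Q(z)Q(w)R(w) = Q(w)R(w) = R(w). Hence R(z)(T - w)R(w) = R(z) and R(z)(T - z)R(w) = R(w). Subtract,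
  using that (T - w) - (T - z) is multiplication by z - w.\<close>

lemma projections_imp_resolvent:
  assumes proj: "\<And>z. z \<in> U \<Longrightarrow> bounded_projection (P z) \<and> bounded_projection (Q z)"
    and rk: "\<And>z. z \<in> U \<Longrightarrow> op_ran UNIV (P z) = op_ran D (shift_op T z) \<and>
                   op_ker UNIV (Q z) = op_ker D (shift_op T z)"
    and PQ: "\<And>z w. z \<in> U \<Longrightarrow> w \<in> U \<Longrightarrow> P z o\<^sub>L P w = P z \<and> Q z o\<^sub>L Q w = Q w"
  shows "\<exists>R. generalized_resolvent D T U R"
proof -
  have "\<exists>R. generalized_inverse D (shift_op T z) R \<and> (\<forall>x. R x \<in> D) \<and>
      (\<forall>x. shift_op T z (R x) = P z x) \<and> (\<forall>x\<in>D. R (shift_op T z x) = Q z x) \<and>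
      R o\<^sub>L P z = R \<and> Q z o\<^sub>L R = R" if "z \<in> U" for z
    using projections_imp_generalized_inverse[of "P z" "Q z" z] proj[OF that] rk[OF that] by simp
  then obtain R where "\<And>z. z \<in> U \<Longrightarrow> generalized_inverse D (shift_op T z) (R z) \<and> (\<forall>x. R z x \<in> D) \<and>
      (\<forall>x. shift_op T z (R z x) = P z x) \<and> (\<forall>x\<in>D. R z (shift_op T z x) = Q z x) \<and>
      R z o\<^sub>L P z = R z \<and> Q z o\<^sub>L R z = R z"
    by metis
  then have R: "\<And>z. z \<in> U \<Longrightarrow> generalized_inverse D (shift_op T z) (R z)"
      "\<And>z x. z \<in> U \<Longrightarrow> R z x \<in> D"
      "\<And>z x. z \<in> U \<Longrightarrow> shift_op T z (R z x) = P z x"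
      "\<And>z x. z \<in> U \<Longrightarrow> x \<in> D \<Longrightarrow> R z (shift_op T z x) = Q z x"
      "\<And>z. z \<in> U \<Longrightarrow> R z o\<^sub>L P z = R z" "\<And>z. z \<in> U \<Longrightarrow> Q z o\<^sub>L R z = R z"
    by simp_all
  have "R z - R w = (z - w) *\<^sub>C (R z o\<^sub>L R w)" if "z \<in> U" "w \<in> U" for z w
  proof (rule blinfun_eqI)
    fix x
    have ops: "R z \<in> bounded_ops" using R(1)[OF that(1)] by (simp add: generalized_inverse_def)
    have "R z o\<^sub>L P w = R z"
      using blinfun_compose_assoc[of "R z" "P z" "P w"] by (simp add: R(5) PQ that)
    then have RP: "R z (P w x) = R z x"
      by (metis blinfun_apply_blinfun_compose)
    have "Q z o\<^sub>L R w = R w"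
      using blinfun_compose_assoc[of "Q z" "Q w" "R w"] by (simp add: R(6) PQ that)
    then have QR: "Q z (R w x) = R w x"
      by (metis blinfun_apply_blinfun_compose)
    have "R z (shift_op T w (R w x)) = R z x" "R z (shift_op T z (R w x)) = R w x"
      by (simp_all add: R(2-4) that RP QR)
    then have "R z x - R w x = R z ((z - w) *\<^sub>C R w x)"
      by (simp add: shift_shift[of w _ z] blinfun.add_right diff_eq_eq add.commute)
    then show "blinfun_apply (R z - R w) x = blinfun_apply ((z - w) *\<^sub>C (R z o\<^sub>L R w)) x"
      by (simp add: blinfun.diff_left scaleC_blinfun.rep_eq bounded_opsD[OF ops])
  qed
  with R(1) show ?thesis unfolding generalized_resolvent_def by blast
qed

section \<open>The two projections attached to a generalized inverse\<close>

text \<open>(T - z)R is everywhere defined and closed, hence bounded by the closed graph theorem.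
  R(T - z) lives only on D, and its assumed continuity is what allows it to be extended to
  Q.\<close>

lemma generalized_inverse_projections:
  assumes "generalized_inverse D (shift_op T z) R"
  obtains P Q where "bounded_projection P" "bounded_projection Q"
    "op_ran UNIV P = op_ran D (shift_op T z)" "op_ker UNIV Q = op_ker D (shift_op T z)"
    "\<And>x. P x = shift_op T z (R x)" "\<And>x. x \<in> D \<Longrightarrow> Q x = R (shift_op T z x)"
proof -
  let ?S = "shift_op T z"
  have Rops: "R \<in> bounded_ops" and RD: "R x \<in> D"
    and SRS: "x \<in> D \<Longrightarrow> ?S (R (?S x)) = ?S x" and RSR: "R (?S (R x)) = R x"
    and cont: "continuous_on D (\<lambda>x. R (?S x))" for x
    using assms unfolding generalized_inverse_def op_ran_def by blast+
  obtain P where P: "P \<in> bounded_ops" "\<And>x. blinfun_apply P x = ?S (R x)"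
  proof (rule closed_graph_bounded_op)
    show "?S (R (x + y)) = ?S (R x) + ?S (R y)" for x y
      by (simp add: blinfun.add_right shift_add RD)
    show "?S (R (a *\<^sub>C x)) = a *\<^sub>C ?S (R x)" for a x
      by (simp add: bounded_opsD[OF Rops] shift_scaleC RD)
    show "?S (R x) = y" if "s \<longlonglongrightarrow> x" "(\<lambda>n. ?S (R (s n))) \<longlonglongrightarrow> y" for s x y
      by (rule shift_closed(2)[OF RD _ that(2)]) (intro blinfun.tendsto tendsto_const that)
  qed blast
  obtain Q where Q: "Q \<in> bounded_ops" "\<And>x. x \<in> D \<Longrightarrow> blinfun_apply Q x = R (?S x)"
  proof (rule extend_bounded_op[OF _ _ cont])
    show "R (?S (x + y)) = R (?S x) + R (?S y)" if "x \<in> D" "y \<in> D" for x y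
      using that by (simp add: blinfun.add_right shift_add)
    show "R (?S (a *\<^sub>C x)) = a *\<^sub>C R (?S x)" if "x \<in> D" for a x
      using that by (simp add: bounded_opsD[OF Rops] shift_scaleC)
  qed blast
  have "bounded_projection P"
    unfolding bounded_projection_def by (auto intro!: blinfun_eqI simp: P RSR)
  moreover have "bounded_projection Q"
    unfolding bounded_projection_def
    by (intro conjI Q blinfun_eq_on_dense[OF dense]) (simp add: Q RD RSR)
  moreover have "op_ran UNIV P = op_ran D ?S"
    unfolding op_ran_def
  proof (intro equalityI subsetI)
    fix y assume "y \<in> ?S ` D"
    then obtain x where "x \<in> D" "y = ?S x" by blast
    then have "y = P y" by (simp add: P SRS)
    then show "y \<in> range (blinfun_apply P)" by blast
  qed (auto simp: P RD)
  moreover have "op_ker UNIV Q = op_ker D ?S"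
    unfolding op_ker_def
  proof (intro equalityI subsetI)
    fix x assume "x \<in> {x \<in> UNIV. Q x = 0}"
    then have Qx: "Q x = 0" by simp
    \<comment> \<open>That x lies in D is not known yet. The vectors s n - Q(s n) lie in the kernel
      of T - z and tend to x - Qx = x, so closedness puts x into that kernel.\<close>
    obtain s where s: "\<And>n. s n \<in> D" "s \<longlonglongrightarrow> x"
      using dense closure_sequential[of x D] by auto
    have "(\<lambda>n. Q (s n)) \<longlonglongrightarrow> Q x"
      by (intro blinfun.tendsto tendsto_const s)
    then have "(\<lambda>n. s n - Q (s n)) \<longlonglongrightarrow> x"
      using tendsto_diff[OF s(2)] Qx by fastforce
    moreover have "s n - Q (s n) \<in> D" "?S (s n - Q (s n)) = 0" for n
      using s(1)[of n] by (simp_all add: Q RD D_diff shift_diff SRS)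
    ultimately show "x \<in> {x \<in> D. ?S x = 0}"
      using shift_closed[of "\<lambda>n. s n - Q (s n)" x z 0] by simp
  next
    fix x assume "x \<in> {x \<in> D. ?S x = 0}"
    then show "x \<in> {x \<in> UNIV. Q x = 0}" by (simp add: Q)
  qed
  ultimately show thesis using that P Q by blast
qed

end

section \<open>The resolvent identity and the differential equation R' = R R\<close>

lemma resolvent_identity_imp_derivative:
  fixes R :: "complex \<Rightarrow> ('a::complex_normed_vector \<Rightarrow>\<^sub>L 'a)"
  assumes "open U" "w \<in> U"
    and res: "\<And>z. z \<in> U \<Longrightarrow> R z - R w = (z - w) *\<^sub>C (R z o\<^sub>L R w)"
  shows "(R has_complex_derivative (R w o\<^sub>L R w)) (at w)"
proof -
  define K where "K = norm (R w)"
  have near_U: "\<forall>\<^sub>F z in at w. z \<in> U"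
    using assms by (auto simp: eventually_at_topological)
  have diff_le: "norm (R z - R w) \<le> cmod (z - w) * (norm (R z) * K)" if "z \<in> U" for z
    using res[OF that] by (simp add: norm_scaleC K_def mult_left_mono norm_blinfun_compose)
  have "((\<lambda>z. cmod (z - w) * K) \<longlongrightarrow> cmod (w - w) * K) (at w)"
    by (intro tendsto_intros)
  then have near: "\<forall>\<^sub>F z in at w. cmod (z - w) * K < 1 / 2"
    by (rule order_tendstoD) simp
  \<comment> \<open>When |z - w| K < 1/2, the identity bounds \<open>norm (R z - R w)\<close> by
    half of \<open>norm (R z)\<close>. Absorbing that half gives \<open>norm (R z)\<close> at most
    2K, and a second use of the identity yields a bound that tends to 0.\<close>
  have bound: "\<forall>\<^sub>F z in at w. norm (R z - R w) \<le> cmod (z - w) * (2 * K * K)"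
    using near near_U
  proof eventually_elim
    case (elim z)
    have "cmod (z - w) * (norm (R z) * K) \<le> 1 / 2 * norm (R z)"
      using elim mult_right_mono[of "cmod (z - w) * K" "1 / 2" "norm (R z)"] by (simp add: mult_ac)
    then have "norm (R z) \<le> 2 * K"
      using diff_le[OF elim(2)] norm_triangle_sub[of "R z" "R w"] by (simp add: K_def)
    then have "cmod (z - w) * (norm (R z) * K) \<le> cmod (z - w) * (2 * K * K)"
      by (intro mult_left_mono mult_right_mono) (auto simp: K_def)
    with diff_le[OF elim(2)] show ?case by linarith
  qed
  have "((\<lambda>z. cmod (z - w) * (2 * K * K)) \<longlongrightarrow> cmod (w - w) * (2 * K * K)) (at w)"
    by (intro tendsto_intros)
  then have "((\<lambda>z. R z - R w) \<longlongrightarrow> 0) (at w)"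
    by (intro Lim_null_comparison[OF bound]) simp
  then have lim: "((\<lambda>z. norm (R z - R w) * K) \<longlongrightarrow> 0) (at w)"
    using tendsto_mult_left_zero tendsto_norm_zero by blast
  have "\<forall>\<^sub>F z in at w. norm (norm ((R z - R w) - (z - w) *\<^sub>C (R w o\<^sub>L R w)) / norm (z - w))
      \<le> norm (R z - R w) * K"
    using near_U eventually_at_ball'[of 1 w UNIV, simplified]
  proof eventually_elim
    case (elim z)
    \<comment> \<open>By the identity the remainder is (z - w)(R(z) - R(w))R(w), so continuity at w
      makes the difference quotient converge.\<close>
    have "(R z - R w) - (z - w) *\<^sub>C (R w o\<^sub>L R w) = (z - w) *\<^sub>C ((R z - R w) o\<^sub>L R w)"
      by (simp only: res[OF elim(1)] flip: scaleC.diff_right blinfun_compose.diff_left)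
    then show ?case
      using elim by (simp add: norm_scaleC K_def norm_blinfun_compose)
  qed
  then have "((\<lambda>z. norm ((R z - R w) - (z - w) *\<^sub>C (R w o\<^sub>L R w)) / norm (z - w)) \<longlongrightarrow> 0) (at w)"
    by (rule Lim_null_comparison) (rule lim)
  then show ?thesis
    unfolding has_complex_derivative_def has_derivative_iff_norm
    by (simp add: scaleC.bounded_linear_left)
qed

text \<open>The zero set of F is closed in U and nonempty. It is also open: on a small ball around a
  zero, the mean value inequality bounds the maximum of \<open>norm (F x)\<close> by half of itself.
  Connectedness does the rest.\<close>

lemma linear_ode_zero:
  fixes F :: "complex \<Rightarrow> ('a::real_normed_vector \<Rightarrow>\<^sub>L 'b::complex_normed_vector)"
    and A :: "complex \<Rightarrow> ('b \<Rightarrow>\<^sub>L 'b)"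
  assumes "open U" "connected U" "continuous_on U A"
    and deriv: "\<And>z. z \<in> U \<Longrightarrow> (F has_complex_derivative (A z o\<^sub>L F z)) (at z)"
    and "w \<in> U" "F w = 0" "z \<in> U"
  shows "F z = 0"
proof -
  define Z where "Z = {z \<in> U. F z = 0}"
  have contF: "continuous_on U F"
    using deriv unfolding has_complex_derivative_def
    by (meson has_derivative_continuous continuous_at_imp_continuous_on)
  have "closedin (top_of_set U) Z"
    unfolding Z_def by (rule continuous_closedin_preimage_constant[OF contF])
  moreover have "open Z"
    unfolding open_contains_ball
  proof
    fix c assume "c \<in> Z"
    then have c: "c \<in> U" "F c = 0" by (auto simp: Z_def)
    \<comment> \<open>Adding 1 makes K positive and leaves room for \<open>norm (A x) < K\<close>
      near c by continuity.\<close>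
    define K where "K = norm (A c) + 1"
    have "\<forall>\<^sub>F x in at c. norm (A x) < K"
      by (rule order_tendstoD(2)[of _ "norm (A c)"])
        (use assms(1,3) c in \<open>auto simp: K_def continuous_on_eq_continuous_at isCont_def intro: tendsto_norm\<close>)
    then obtain d where d: "d > 0" "\<And>x. x \<noteq> c \<Longrightarrow> dist x c < d \<Longrightarrow> norm (A x) < K"
      by (auto simp: eventually_at)
    obtain e where e: "e > 0" "ball c e \<subseteq> U"
      using \<open>open U\<close> c(1) by (meson openE)
    have K: "K > 0" by (simp add: K_def add_nonneg_pos)
    \<comment> \<open>The halves keep the closed ball of radius r strictly inside the balls of
      radius d and e; the last term ensures K r is at most 1/2.\<close>
    define r where "r = min (min (d / 2) (e / 2)) (1 / (2 * K))"
    have r: "r > 0" "r < d" "r < e"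
      using d(1) e(1) K by (auto simp: r_def)
    have Kr: "K * r \<le> 1 / 2"
      using mult_left_mono[of r "1 / (2 * K)" K] K by (simp add: r_def)
    have sub: "cball c r \<subseteq> U" using e r by force
    have AK: "norm (A x) \<le> K" if "x \<in> cball c r" for x
      using that d(2)[of x] r by (cases "x = c") (auto simp: K_def dist_commute)
    obtain m where m: "m \<in> cball c r" "\<And>x. x \<in> cball c r \<Longrightarrow> norm (F x) \<le> norm (F m)"
    proof -
      have "\<exists>m\<in>cball c r. \<forall>x\<in>cball c r. norm (F x) \<le> norm (F m)"
        by (intro continuous_attains_sup continuous_on_norm continuous_on_subset[OF contF sub])
          (use r in auto)
      then show thesis using that by blast
    qed
    have "norm (F m - F c) \<le> (K * norm (F m)) * norm (m - c)"
    proof (rule differentiable_bound[OF convex_cball])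
      fix x assume x: "x \<in> cball c r"
      show "(F has_derivative (\<lambda>h. h *\<^sub>C (A x o\<^sub>L F x))) (at x within cball c r)"
        using deriv[OF subsetD[OF sub x]] unfolding has_complex_derivative_def
        by (rule has_derivative_at_withinI)
      have "norm (A x o\<^sub>L F x) \<le> K * norm (F m)"
        using norm_blinfun_compose[of "A x" "F x"] mult_mono[OF AK[OF x] m(2)[OF x]] K by simp
      then show "onorm (\<lambda>h. h *\<^sub>C (A x o\<^sub>L F x)) \<le> K * norm (F m)"
        using K by (intro onorm_bound)
          (auto simp: norm_scaleC mult.commute[of "K * _"] intro: mult_left_mono)
    qed (use m r in auto)
    also have "\<dots> \<le> (K * norm (F m)) * r"
      using m(1) K by (intro mult_left_mono) (auto simp: dist_norm norm_minus_commute)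
    also have "\<dots> = (K * r) * norm (F m)" by simp
    also have "\<dots> \<le> 1 / 2 * norm (F m)" by (rule mult_right_mono[OF Kr]) simp
    finally have "F m = 0" using c by simp
    then have "F x = 0" if "x \<in> cball c r" for x using m(2)[OF that] by simp
    then have "ball c r \<subseteq> Z" using sub by (auto simp: Z_def)
    then show "\<exists>e>0. ball c e \<subseteq> Z" using r by blast
  qed
  then have "openin (top_of_set U) Z"
    by (rule open_openin_trans[OF \<open>open U\<close>]) (auto simp: Z_def)
  moreover have "Z \<noteq> {}" using assms by (auto simp: Z_def)
  ultimately have "Z = U" using \<open>connected U\<close> unfolding connected_clopen by blast
  then show ?thesis using \<open>z \<in> U\<close> by (auto simp: Z_def)
qed

lemma derivative_square_imp_resolvent_identity:
  fixes R :: "complex \<Rightarrow> ('a::complex_normed_vector \<Rightarrow>\<^sub>L 'a)"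
  assumes "open U" "connected U"
    and ops: "\<And>z. z \<in> U \<Longrightarrow> R z \<in> bounded_ops"
    and deriv: "\<And>z. z \<in> U \<Longrightarrow> (R has_complex_derivative (R z o\<^sub>L R z)) (at z)"
    and zw: "z \<in> U" "w \<in> U"
  shows "R z - R w = (z - w) *\<^sub>C (R z o\<^sub>L R w)"
proof -
  define F where "F z = R z - R w - (z - w) *\<^sub>C (R z o\<^sub>L R w)" for z
  have "(F has_complex_derivative (R z o\<^sub>L F z)) (at z)" if "z \<in> U" for z
  proof -
    note d = deriv[OF that, unfolded has_complex_derivative_def]
    have comp: "((\<lambda>z. R z o\<^sub>L R w) has_derivative (\<lambda>h. (h *\<^sub>C (R z o\<^sub>L R z)) o\<^sub>L R w)) (at z)"
      by (rule bounded_linear.has_derivative[OF blinfun_compose.bounded_linear_left d])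
    have lin: "((\<lambda>z. z - w) has_derivative (\<lambda>h. h)) (at z)"
      by (auto intro!: derivative_eq_intros)
    have "(F has_derivative (\<lambda>h. h *\<^sub>C (R z o\<^sub>L R z) - 0 -
        ((z - w) *\<^sub>C ((h *\<^sub>C (R z o\<^sub>L R z)) o\<^sub>L R w) + h *\<^sub>C (R z o\<^sub>L R w)))) (at z)"
      unfolding F_def
      by (intro has_derivative_diff d has_derivative_const scaleC.FDERIV[OF lin comp])
    \<comment> \<open>Using R' = R R, the derivative of F is R(z)R(z) - R(z)R(w) - (z -
      w)R(z)R(z)R(w), from which R(z) factors out on the left. Moving the scalars past R(z) needs
      its complex linearity.\<close>
    moreover have "h *\<^sub>C (R z o\<^sub>L R z) - 0 -
        ((z - w) *\<^sub>C ((h *\<^sub>C (R z o\<^sub>L R z)) o\<^sub>L R w) + h *\<^sub>C (R z o\<^sub>L R w)) = h *\<^sub>C (R z o\<^sub>L F z)" for h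
      by (rule blinfun_eqI)
        (simp add: F_def blinfun.diff_left blinfun.diff_right blinfun.add_left scaleC_blinfun.rep_eq
          bounded_opsD[OF ops[OF that]] scaleC.diff_right scaleC_scaleC mult.commute)
    ultimately show ?thesis unfolding has_complex_derivative_def by simp
  qed
  moreover have "continuous_on U R"
    using deriv unfolding has_complex_derivative_def
    by (meson has_derivative_continuous continuous_at_imp_continuous_on)
  moreover have "F w = 0" by (simp add: F_def scaleC.zero_left)
  ultimately have "F z = 0"
    using linear_ode_zero[of U R F w z] assms by blast
  then show ?thesis by (simp add: F_def)
qed

section \<open>From a generalized resolvent to continuous families of projections\<close>

text \<open>The projections are those of each generalized inverse R(z). For a fixed base point w,
  both are explicit expressions in R(z), so they inherit its continuity. The product rules hold
  because the resolvent identity forces all R(z) to have the same kernel and the same range.\<close>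

lemma (in closed_op) resolvent_imp_projections:
  assumes "open U" and R: "generalized_resolvent D T U R"
  shows "\<exists>P Q :: complex \<Rightarrow> ('a \<Rightarrow>\<^sub>L 'a).
    (\<forall>z\<in>U. bounded_projection (P z) \<and> bounded_projection (Q z)) \<and>
    continuous_on U P \<and> continuous_on U Q \<and>
    (\<forall>z\<in>U. op_ran UNIV (P z) = op_ran D (shift_op T z) \<and>
           op_ker UNIV (Q z) = op_ker D (shift_op T z)) \<and>
    (\<forall>z\<in>U. \<forall>w\<in>U. P z o\<^sub>L P w = P z \<and> Q z o\<^sub>L Q w = Q w)"
proof -
  have gi: "\<And>z. z \<in> U \<Longrightarrow> generalized_inverse D (shift_op T z) (R z)"
    and res: "\<And>z w. z \<in> U \<Longrightarrow> w \<in> U \<Longrightarrow> R z - R w = (z - w) *\<^sub>C (R z o\<^sub>L R w)"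
    using R unfolding generalized_resolvent_def by blast+
  have ops: "R z \<in> bounded_ops" and RD: "R z x \<in> D"
    and SRS: "x \<in> D \<Longrightarrow> shift_op T z (R z (shift_op T z x)) = shift_op T z x"
    and RSR: "R z (shift_op T z (R z x)) = R z x" if "z \<in> U" for z x
    using gi[OF that] unfolding generalized_inverse_def op_ran_def by blast+
  have res1: "R z x = R w x + (z - w) *\<^sub>C R z (R w x)" if "z \<in> U" "w \<in> U" for z w x
    using arg_cong[OF res[OF that], of "\<lambda>A. blinfun_apply A x"]
    by (simp add: blinfun.diff_left scaleC_blinfun.rep_eq algebra_simps)
  \<comment> \<open>Exchanging z and w gives the identity with the factors in the other order, so
    R(z) and R(w) may appear either way round.\<close>
  have res2: "R z x = R w x + (z - w) *\<^sub>C R w (R z x)" if "z \<in> U" "w \<in> U" for z w x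
    using res1[OF that(2,1), of x] by (simp add: scaleC.diff_left algebra_simps)
  have contR: "continuous_on U R"
    using resolvent_identity_imp_derivative[OF \<open>open U\<close> _ res] unfolding has_complex_derivative_def
    by (meson has_derivative_continuous continuous_at_imp_continuous_on)
  have "\<exists>P Q. bounded_projection P \<and> bounded_projection Q \<and>
      op_ran UNIV P = op_ran D (shift_op T z) \<and> op_ker UNIV Q = op_ker D (shift_op T z) \<and>
      (\<forall>x. P x = shift_op T z (R z x)) \<and> (\<forall>x\<in>D. Q x = R z (shift_op T z x))" if "z \<in> U" for z
    using generalized_inverse_projections[OF gi[OF that]] by metis
  then obtain P Q where
    proj: "\<And>z. z \<in> U \<Longrightarrow> bounded_projection (P z) \<and> bounded_projection (Q z)" and
    rk: "\<And>z. z \<in> U \<Longrightarrow> op_ran UNIV (P z) = op_ran D (shift_op T z) \<and>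
                   op_ker UNIV (Q z) = op_ker D (shift_op T z)" and
    P: "\<And>z x. z \<in> U \<Longrightarrow> P z x = shift_op T z (R z x)" and
    Q: "\<And>z x. z \<in> U \<Longrightarrow> x \<in> D \<Longrightarrow> Q z x = R z (shift_op T z x)"
    by metis
  have P_eq: "P z = P w + (z - w) *\<^sub>C ((P w o\<^sub>L R z) - R z)" if "z \<in> U" "w \<in> U" for z w
  proof (rule blinfun_eqI)
    fix x
    have "P z x = shift_op T w (R z x) - (z - w) *\<^sub>C R z x"
      by (simp add: P that shift_shift[of w _ z])
    also have "shift_op T w (R z x) = shift_op T w (R w x + (z - w) *\<^sub>C R w (R z x))"
      using res2[OF that, of x] by simp
    also have "\<dots> = P w x + (z - w) *\<^sub>C P w (R z x)"
      by (simp add: shift_add shift_scaleC RD D_scaleC that P)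
    finally show "blinfun_apply (P z) x = blinfun_apply (P w + (z - w) *\<^sub>C ((P w o\<^sub>L R z) - R z)) x"
      by (simp add: blinfun.add_left blinfun.diff_left scaleC_blinfun.rep_eq scaleC.diff_right)
  qed
  \<comment> \<open>On D, where Q is given by R(T - z), split T - z as (T - w) - (z - w) and apply
    the resolvent identity to (T - w)x. Density extends the result.\<close>
  have Q_eq: "Q z = Q w + (z - w) *\<^sub>C ((R z o\<^sub>L Q w) - R z)" if "z \<in> U" "w \<in> U" for z w
  proof (rule blinfun_eq_on_dense[OF dense])
      fix x assume x: "x \<in> D"
      have "Q z x = R z (shift_op T w x) - R z ((z - w) *\<^sub>C x)"
        using that x by (simp add: Q shift_shift[of w _ z] blinfun.add_right)
      also have "R z (shift_op T w x) = Q w x + (z - w) *\<^sub>C R z (Q w x)"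
        using res1[OF that, of "shift_op T w x"] that x by (simp add: Q)
      finally show "Q z x = blinfun_apply (Q w + (z - w) *\<^sub>C ((R z o\<^sub>L Q w) - R z)) x"
        by (simp add: blinfun.add_left blinfun.diff_left scaleC_blinfun.rep_eq scaleC.diff_right
            bounded_opsD[OF ops[OF that(1)]])
    qed
  have "continuous_on U P \<and> continuous_on U Q"
  proof (cases "U = {}")
    case False
    then obtain w where w: "w \<in> U" by blast
    show ?thesis
    proof
      have "continuous_on U (\<lambda>z. P w + (z - w) *\<^sub>C ((P w o\<^sub>L R z) - R z))"
        by (intro continuous_intros contR)
      then show "continuous_on U P"
        by (rule continuous_on_eq) (rule P_eq[OF _ w, symmetric])
      have "continuous_on U (\<lambda>z. Q w + (z - w) *\<^sub>C ((R z o\<^sub>L Q w) - R z))"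
        by (intro continuous_intros contR)
      then show "continuous_on U Q"
        by (rule continuous_on_eq) (rule Q_eq[OF _ w, symmetric])
    qed
  qed simp
  moreover have "P z o\<^sub>L P w = P z" if "z \<in> U" "w \<in> U" for z w
  proof (rule blinfun_eqI)
    fix x
    \<comment> \<open>x - P(w)x lies in the kernel of R(w), hence in that of R(z). Therefore
      R(z)P(w) = R(z), and applying T - z gives P(z)P(w) = P(z).\<close>
    have "R w (x - P w x) = 0"
      using RSR[OF that(2), of x] by (simp add: P that blinfun.diff_right)
    then have "R z (x - P w x) = 0"
      using res1[OF that, of "x - P w x"] by (simp add: blinfun.zero_right scaleC.zero_right)
    then have "R z (P w x) = R z x"
      by (simp add: blinfun.diff_right)
    then show "blinfun_apply (P z o\<^sub>L P w) x = blinfun_apply (P z) x"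
      by (simp add: P[OF that(1)])
  qed
  moreover have "Q z o\<^sub>L Q w = Q w" if "z \<in> U" "w \<in> U" for z w
  proof (rule blinfun_eq_on_dense[OF dense])
    have QR: "Q z (R z y) = R z y" for y
      using RSR[OF that(1)] by (simp add: Q that RD)
    \<comment> \<open>The resolvent identity exhibits R(w)y as a value of R(z), and Q(z) fixes all
      such values.\<close>
    have fix_R: "Q z (R w y) = R w y" for y
    proof -
      have "R w y = R z (y + (w - z) *\<^sub>C R w y)"
        by (rule trans[OF res2[OF that(2,1)]])
          (simp add: blinfun.add_right bounded_opsD[OF ops[OF that(1)]])
      then obtain v where "R w y = R z v" by blast
      then show ?thesis by (simp add: QR)
    qed
    show "blinfun_apply (Q z o\<^sub>L Q w) x = blinfun_apply (Q w) x" if "x \<in> D" for x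
      using that by (simp add: Q[OF \<open>w \<in> U\<close>] fix_R)
  qed
  ultimately show ?thesis
    by (intro exI[of _ P] exI[of _ Q] conjI ballI) (simp_all add: proj rk)
qed

theorem theorem2p7:
  fixes D :: "'a::complex_banach set" and T :: "'a \<Rightarrow> 'a" and U :: "complex set"
  assumes "closed_densely_defined D T" and "open U" and "connected U"
  shows "((\<exists>P Q :: complex \<Rightarrow> ('a \<Rightarrow>\<^sub>L 'a).
            (\<forall>z\<in>U. bounded_projection (P z) \<and> bounded_projection (Q z)) \<and>
            continuous_on U P \<and> continuous_on U Q \<and>
            (\<forall>z\<in>U. op_ran UNIV (P z) = op_ran D (shift_op T z) \<and>
                   op_ker UNIV (Q z) = op_ker D (shift_op T z)) \<and>
            (\<forall>z\<in>U. \<forall>w\<in>U. P z o\<^sub>L P w = P z \<and> Q z o\<^sub>L Q w = Q w))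
          \<longleftrightarrow> (\<exists>R. generalized_resolvent D T U R))
      \<and> ((\<exists>R. generalized_resolvent D T U R)
          \<longleftrightarrow> (\<exists>R. analytic_generalized_inverse D T U R \<and>
                (\<forall>z\<in>U. (R has_complex_derivative (R z o\<^sub>L R z)) (at z))))"
proof -
  interpret closed_op D T by unfold_locales fact
  show ?thesis
  proof (intro conjI iffI)
    assume "\<exists>P Q :: complex \<Rightarrow> ('a \<Rightarrow>\<^sub>L 'a).
            (\<forall>z\<in>U. bounded_projection (P z) \<and> bounded_projection (Q z)) \<and>
            continuous_on U P \<and> continuous_on U Q \<and>
            (\<forall>z\<in>U. op_ran UNIV (P z) = op_ran D (shift_op T z) \<and>
                   op_ker UNIV (Q z) = op_ker D (shift_op T z)) \<and>
            (\<forall>z\<in>U. \<forall>w\<in>U. P z o\<^sub>L P w = P z \<and> Q z o\<^sub>L Q w = Q w)"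
    then obtain P Q :: "complex \<Rightarrow> ('a \<Rightarrow>\<^sub>L 'a)" where
      "\<And>z. z \<in> U \<Longrightarrow> bounded_projection (P z) \<and> bounded_projection (Q z)"
      "\<And>z. z \<in> U \<Longrightarrow> op_ran UNIV (P z) = op_ran D (shift_op T z) \<and>
                   op_ker UNIV (Q z) = op_ker D (shift_op T z)"
      "\<And>z w. z \<in> U \<Longrightarrow> w \<in> U \<Longrightarrow> P z o\<^sub>L P w = P z \<and> Q z o\<^sub>L Q w = Q w"
      by metis
    then show "\<exists>R. generalized_resolvent D T U R" by (rule projections_imp_resolvent)
  next
    assume "\<exists>R. generalized_resolvent D T U R"
    then show "\<exists>P Q :: complex \<Rightarrow> ('a \<Rightarrow>\<^sub>L 'a).
            (\<forall>z\<in>U. bounded_projection (P z) \<and> bounded_projection (Q z)) \<and>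
            continuous_on U P \<and> continuous_on U Q \<and>
            (\<forall>z\<in>U. op_ran UNIV (P z) = op_ran D (shift_op T z) \<and>
                   op_ker UNIV (Q z) = op_ker D (shift_op T z)) \<and>
            (\<forall>z\<in>U. \<forall>w\<in>U. P z o\<^sub>L P w = P z \<and> Q z o\<^sub>L Q w = Q w)"
      using resolvent_imp_projections[OF \<open>open U\<close>] by blast
  next
    assume "\<exists>R. generalized_resolvent D T U R"
    then obtain R where gi: "\<And>z. z \<in> U \<Longrightarrow> generalized_inverse D (shift_op T z) (R z)"
      and res: "\<And>z w. z \<in> U \<Longrightarrow> w \<in> U \<Longrightarrow> R z - R w = (z - w) *\<^sub>C (R z o\<^sub>L R w)"
      unfolding generalized_resolvent_def by metis
    have deriv: "(R has_complex_derivative (R z o\<^sub>L R z)) (at z)" if "z \<in> U" for z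
      using resolvent_identity_imp_derivative[OF \<open>open U\<close> that res] that by blast
    \<comment> \<open>Analyticity asks for a derivative throughout a ball around each point;
      openness of U provides the ball.\<close>
    then have "R vector_analytic_on U"
      using \<open>open U\<close> unfolding vector_analytic_on_def by (meson openE subsetD)
    with gi deriv show "\<exists>R. analytic_generalized_inverse D T U R \<and>
                (\<forall>z\<in>U. (R has_complex_derivative (R z o\<^sub>L R z)) (at z))"
      unfolding analytic_generalized_inverse_def by blast
  next
    assume "\<exists>R. analytic_generalized_inverse D T U R \<and>
                (\<forall>z\<in>U. (R has_complex_derivative (R z o\<^sub>L R z)) (at z))"
    then obtain R where gi: "\<And>z. z \<in> U \<Longrightarrow> generalized_inverse D (shift_op T z) (R z)"
      and deriv: "\<And>z. z \<in> U \<Longrightarrow> (R has_complex_derivative (R z o\<^sub>L R z)) (at z)"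
      unfolding analytic_generalized_inverse_def by blast
    have "R z \<in> bounded_ops" if "z \<in> U" for z
      using gi[OF that] by (simp add: generalized_inverse_def)
    then have "R z - R w = (z - w) *\<^sub>C (R z o\<^sub>L R w)" if "z \<in> U" "w \<in> U" for z w
      using derivative_square_imp_resolvent_identity[OF \<open>open U\<close> \<open>connected U\<close> _ deriv that] by blast
    with gi show "\<exists>R. generalized_resolvent D T U R"
      unfolding generalized_resolvent_def by blast
  qed
qed

end
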